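(* Let $G$ be a finitely generated group, let $0\in A$ where $A$ is a finite alphabet, and suppose $X\subset A^G$ is a subshift of finite type such that $0$ is a safe symbol for $X$. Then $X$ is uniformly avo for the family $\mathcal P(G\setminus\{e\})$ of all subsets of $G\setminus\{e\}$.
   Context: $G$ carries a finite generating set and the left-invariant word metric $d$; $\mathcal B_n=\{g: d(e,g)\le n\}$. $G$ acts on $A^G$ by $(gx)_h=x_{g^{-1}h}$; a subshift is a closed $G$-invariant $X\subset A^G$; it is of finite type if it is the set of all $x\in A^G$ in which no pattern (element of $A^D$, $D$ finite) from some fixed finite set occurs at any translate. $X|C=\{x|C:x\in X\}$. The symbol $0$ is a safe symbol for $X$ if whenever $y\in A^G$ and for some $x\in X$ we have $y_g\in\{x_g,0\}$ for all $g\in G$, then $y\in X$. $X$ is uniformly avo for a family $\mathcal C$ of subsets of $G\setminus\{e\}$ if there is $r\in\mathbb N$ such that for every $C\in\mathcal C$, with $B=C\cap\mathcal B_r$, for all $x\in X|C$ and $a\in A$: $(x|B)\sqcup a^e\in X|(B\cup\{e\})\iff x\sqcup a^e\in X|(C\cup\{e\})$, where $a^e$ is the pattern with domain $\{e\}$ and value $a$ and $\sqcup$ is union of patterns. *)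

theory Defs
  imports "HOL-Algebra.Generated_Groups" "HOL-Analysis.Analysis"
begin

text \<open>
  The alphabet is a set \<open>A\<close>; a configuration on \<open>G\<close> is an element of the extensional function
  space \<open>carrier G \<rightarrow>\<^sub>E A\<close>, and a pattern with domain \<open>D\<close> an element of \<open>D \<rightarrow>\<^sub>E A\<close>.
\<close>

definition word_length :: "('g, 'm) monoid_scheme \<Rightarrow> 'g set \<Rightarrow> 'g \<Rightarrow> nat" where
  "word_length G S g =
     (LEAST n. \<exists>ws. length ws = n \<and> set ws \<subseteq> S \<union> m_inv G ` S \<and>
                     foldr (\<otimes>\<^bsub>G\<^esub>) ws \<one>\<^bsub>G\<^esub> = g)"

definition word_dist :: "('g, 'm) monoid_scheme \<Rightarrow> 'g set \<Rightarrow> 'g \<Rightarrow> 'g \<Rightarrow> nat" where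
  "word_dist G S g h = word_length G S (inv\<^bsub>G\<^esub> g \<otimes>\<^bsub>G\<^esub> h)"

definition word_ball :: "('g, 'm) monoid_scheme \<Rightarrow> 'g set \<Rightarrow> nat \<Rightarrow> 'g set" where
  "word_ball G S n = {g \<in> carrier G. word_dist G S \<one>\<^bsub>G\<^esub> g \<le> n}"

definition translate :: "('g, 'm) monoid_scheme \<Rightarrow> 'g \<Rightarrow> ('g \<Rightarrow> 'a) \<Rightarrow> 'g \<Rightarrow> 'a" where
  "translate G g x = (\<lambda>h\<in>carrier G. x (inv\<^bsub>G\<^esub> g \<otimes>\<^bsub>G\<^esub> h))"

definition subshift :: "('g, 'm) monoid_scheme \<Rightarrow> 'a set \<Rightarrow> ('g \<Rightarrow> 'a) set \<Rightarrow> bool" where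
  "subshift G A X \<longleftrightarrow>
     closedin (product_topology (\<lambda>_. discrete_topology A) (carrier G)) X \<and>
     (\<forall>g\<in>carrier G. \<forall>x\<in>X. translate G g x \<in> X)"

text \<open>
  A pattern is carried as a pair \<open>(D, p)\<close>, since \<open>p\<close> alone does not determine its domain
  when \<open>undefined \<in> A\<close>.
\<close>

definition occurs_in ::
  "('g, 'm) monoid_scheme \<Rightarrow> 'g set \<times> ('g \<Rightarrow> 'a) \<Rightarrow> ('g \<Rightarrow> 'a) \<Rightarrow> bool" where
  "occurs_in G P x \<longleftrightarrow> (\<exists>g\<in>carrier G. restrict (translate G g x) (fst P) = snd P)"

definition finite_type :: "('g, 'm) monoid_scheme \<Rightarrow> 'a set \<Rightarrow> ('g \<Rightarrow> 'a) set \<Rightarrow> bool" where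
  "finite_type G A X \<longleftrightarrow>
     (\<exists>F. finite F \<and>
          (\<forall>(D, p)\<in>F. finite D \<and> D \<subseteq> carrier G \<and> p \<in> D \<rightarrow>\<^sub>E A) \<and>
          X = {x \<in> carrier G \<rightarrow>\<^sub>E A. \<forall>P\<in>F. \<not> occurs_in G P x})"

definition safe_symbol ::
  "('g, 'm) monoid_scheme \<Rightarrow> 'a set \<Rightarrow> ('g \<Rightarrow> 'a) set \<Rightarrow> 'a \<Rightarrow> bool" where
  "safe_symbol G A X z \<longleftrightarrow>
     (\<forall>y \<in> carrier G \<rightarrow>\<^sub>E A.
        (\<exists>x\<in>X. \<forall>g\<in>carrier G. y g \<in> {x g, z}) \<longrightarrow> y \<in> X)"

definition restrict_set :: "('g \<Rightarrow> 'a) set \<Rightarrow> 'g set \<Rightarrow> ('g \<Rightarrow> 'a) set" where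
  "restrict_set X C = (\<lambda>x. restrict x C) ` X"

definition single :: "'g \<Rightarrow> 'a \<Rightarrow> 'g \<Rightarrow> 'a" where
  "single g a = (\<lambda>h\<in>{g}. a)"

text \<open>
  For \<open>x\<close> with domain \<open>C\<close> and \<open>y\<close> with domain \<open>D\<close>, disjoint from \<open>C\<close>, the union of
  the patterns \<open>x\<close> and \<open>y\<close> is \<open>merge C D (x, y)\<close>.
\<close>

definition uniformly_avo ::
  "('g, 'm) monoid_scheme \<Rightarrow> 'g set \<Rightarrow> 'a set \<Rightarrow> ('g \<Rightarrow> 'a) set \<Rightarrow> 'g set set \<Rightarrow> bool" where
  "uniformly_avo G S A X \<C> \<longleftrightarrow>
     (\<exists>r. \<forall>C\<in>\<C>. let B = C \<inter> word_ball G S r; e = \<one>\<^bsub>G\<^esub> in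
        \<forall>x\<in>restrict_set X C. \<forall>a\<in>A.
          merge B {e} (restrict x B, single e a) \<in> restrict_set X (B \<union> {e}) \<longleftrightarrow>
          merge C {e} (x, single e a) \<in> restrict_set X (C \<union> {e}))"

end

theory Submission
  imports Defs
begin

text \<open>
  Membership in a subshift of finite type is tested by finitely many finite patterns. A forbidden
  pattern with domain \<open>D\<close>, occurring at a place where it covers \<open>e\<close>, only sees sites of the
  form \<open>d\<inverse> h\<close> with \<open>d, h \<in> D\<close>; these form a finite window \<open>N\<close> that does not depend on the
  configuration. So whether a configuration may carry the value \<open>a\<close> at \<open>e\<close> is a question about
  \<open>N\<close> alone, provided that the rest of the configuration is already admissible
  (\<open>finite_type_glue_at_one\<close>).

  Choose \<open>r\<close> so that \<open>N \<subseteq> \<B>\<^sub>r\<close>. Given \<open>x \<in> X|C\<close> such that \<open>(x|B) \<squnion> a\<^sup>e\<close> extends to a point \<open>w\<close> of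
  \<open>X\<close>, fill \<open>x \<squnion> a\<^sup>e\<close> up with the safe symbol to a configuration \<open>y\<close>. Off \<open>e\<close> it agrees with an
  extension of \<open>x\<close> in \<open>X\<close> whose values outside \<open>C\<close> have been erased, and on \<open>N\<close> it agrees with
  \<open>w\<close> after erasing the values outside \<open>B \<union> {e}\<close>. Both erased configurations lie in \<open>X\<close> since the
  symbol is safe, hence so does \<open>y\<close>. The safe symbol makes this work because \<open>w\<close> need not agree with
  the extension of \<open>x\<close> at the sites of \<open>N\<close> outside \<open>C\<close>; erasing both removes the conflict. The
  converse direction is restriction.
\<close>

lemma finite_subset_word_ball:
  assumes "finite N" and "N \<subseteq> carrier G"
  shows "\<exists>r. N \<subseteq> word_ball G S r"
proof -
  obtain r where "\<forall>n \<in> word_dist G S \<one>\<^bsub>G\<^esub> ` N. n \<le> r"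
    using assms(1) finite_nat_set_iff_bounded_le[of "word_dist G S \<one>\<^bsub>G\<^esub> ` N"] by auto
  then have "N \<subseteq> word_ball G S r"
    using assms(2) by (auto simp: word_ball_def)
  then show ?thesis ..
qed

lemma occurrence_cong:
  assumes "group G" and "g \<in> carrier G" and "D \<subseteq> carrier G"
    and "\<And>h. h \<in> D \<Longrightarrow> x (inv\<^bsub>G\<^esub> g \<otimes>\<^bsub>G\<^esub> h) = y (inv\<^bsub>G\<^esub> g \<otimes>\<^bsub>G\<^esub> h)"
  shows "restrict (translate G g x) D = restrict (translate G g y) D"
  using assms(3,4) by (auto simp: translate_def fun_eq_iff restrict_def)

text \<open>
  An occurrence of a forbidden pattern either misses the identity, and is then already visible
  in \<open>u\<close>, or covers it, and is then visible in \<open>w\<close>. In the second case the occurrence is at some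
  \<open>d\<close> in the domain \<open>D\<close> of the pattern, since the sites read there are \<open>d\<inverse> D\<close>.
\<close>

lemma finite_type_glue_at_one:
  fixes G :: "('g, 'm) monoid_scheme"
  assumes "group G" and "finite_type G A X"
  obtains N where "finite N" "N \<subseteq> carrier G"
    and "\<And>y u w. \<lbrakk>y \<in> carrier G \<rightarrow>\<^sub>E A; u \<in> X; w \<in> X;
           \<And>g. g \<in> carrier G - {\<one>\<^bsub>G\<^esub>} \<Longrightarrow> y g = u g; \<And>g. g \<in> N \<Longrightarrow> y g = w g\<rbrakk> \<Longrightarrow> y \<in> X"
proof -
  interpret group G by fact
  obtain F where "finite F"
    and F: "\<And>D p. (D, p) \<in> F \<Longrightarrow> finite D \<and> D \<subseteq> carrier G"
    and X: "X = {x \<in> carrier G \<rightarrow>\<^sub>E A. \<forall>P\<in>F. \<not> occurs_in G P x}"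
    using assms(2) unfolding finite_type_def by fastforce
  define N where "N = (\<Union>P\<in>F. (\<lambda>(d, h). inv\<^bsub>G\<^esub> d \<otimes>\<^bsub>G\<^esub> h) ` (fst P \<times> fst P))"
  show thesis
  proof
    show "finite N"
      unfolding N_def using \<open>finite F\<close> F by auto
    show "N \<subseteq> carrier G"
      unfolding N_def using F by fastforce
  next
    fix y u w
    assume y: "y \<in> carrier G \<rightarrow>\<^sub>E A" and "u \<in> X" "w \<in> X"
      and yu: "\<And>g. g \<in> carrier G - {\<one>\<^bsub>G\<^esub>} \<Longrightarrow> y g = u g" and yw: "\<And>g. g \<in> N \<Longrightarrow> y g = w g"
    have "\<not> occurs_in G P y" if "P \<in> F" for P
    proof
      assume "occurs_in G P y"
      then obtain g where g: "g \<in> carrier G"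
        and occ: "restrict (translate G g y) (fst P) = snd P"
        by (auto simp: occurs_in_def)
      have D: "fst P \<subseteq> carrier G"
        using F[of "fst P" "snd P"] \<open>P \<in> F\<close> by simp
      show False
      proof (cases "g \<in> fst P")
        case True
        then have "restrict (translate G g y) (fst P) = restrict (translate G g w) (fst P)"
          using \<open>P \<in> F\<close> by (intro occurrence_cong[OF assms(1) g D] yw) (force simp: N_def)
        with occ g have "occurs_in G P w"
          by (auto simp: occurs_in_def)
        with \<open>w \<in> X\<close> \<open>P \<in> F\<close> show False
          by (auto simp: X)
      next
        case False
        have "inv\<^bsub>G\<^esub> g \<otimes>\<^bsub>G\<^esub> h \<in> carrier G - {\<one>\<^bsub>G\<^esub>}" if "h \<in> fst P" for h
        proof -
          have h: "h \<in> carrier G" "h \<noteq> g"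
            using that D False by auto
          then have "inv\<^bsub>G\<^esub> g \<otimes>\<^bsub>G\<^esub> h \<noteq> \<one>\<^bsub>G\<^esub>"
            using g inv_solve_left'[of "\<one>\<^bsub>G\<^esub>" g h] by auto
          then show ?thesis
            using g h by simp
        qed
        then have "restrict (translate G g y) (fst P) = restrict (translate G g u) (fst P)"
          by (intro occurrence_cong[OF assms(1) g D] yu)
        with occ g have "occurs_in G P u"
          by (auto simp: occurs_in_def)
        with \<open>u \<in> X\<close> \<open>P \<in> F\<close> show False
          by (auto simp: X)
      qed
    qed
    with y show "y \<in> X"
      by (auto simp: X)
  qed
qed

lemma safe_symbol_erase:
  assumes "safe_symbol G A X z" and "z \<in> A" and "X \<subseteq> carrier G \<rightarrow>\<^sub>E A" and "x \<in> X"
  shows "(\<lambda>g\<in>carrier G. if g \<in> C then x g else z) \<in> X" (is "?y \<in> X")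
proof -
  have "?y \<in> carrier G \<rightarrow>\<^sub>E A"
    using assms(2) PiE_mem[OF subsetD[OF assms(3,4)]] by simp
  moreover have "\<forall>g\<in>carrier G. ?y g \<in> {x g, z}"
    by simp
  ultimately show ?thesis
    using assms(1,4) unfolding safe_symbol_def by blast
qed

lemma restrict_set_mono:
  assumes "restrict x C \<in> restrict_set X C" and "B \<subseteq> C"
  shows "restrict x B \<in> restrict_set X B"
proof -
  obtain w where "w \<in> X" and w: "restrict x C = restrict w C"
    using assms(1) by (auto simp: restrict_set_def)
  from w have "restrict (restrict x C) B = restrict (restrict w C) B"
    by (rule arg_cong)
  then have "restrict x B = restrict w B"
    using assms(2) by (simp only: restrict_restrict inf.absorb2)
  from this \<open>w \<in> X\<close> show ?thesis
    unfolding restrict_set_def by (rule image_eqI)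
qed

theorem proposition4p7:
  fixes G :: "('g, 'm) monoid_scheme"
    and S :: "'g set"
    and A :: "'a set"
    and z :: 'a
    and X :: "('g \<Rightarrow> 'a) set"
  assumes "group G"
    and "finite S" and "S \<subseteq> carrier G" and "generate G S = carrier G"
    and "finite A" and "z \<in> A"
    and "subshift G A X" and "finite_type G A X"
    and "safe_symbol G A X z"
  shows "uniformly_avo G S A X (Pow (carrier G - {\<one>\<^bsub>G\<^esub>}))"
proof -
  interpret group G by fact
  have XA: "X \<subseteq> carrier G \<rightarrow>\<^sub>E A"
    using \<open>finite_type G A X\<close> by (auto simp: finite_type_def)
  note erase = safe_symbol_erase[OF \<open>safe_symbol G A X z\<close> \<open>z \<in> A\<close> XA]
  obtain N where "finite N" "N \<subseteq> carrier G"
    and glue: "\<And>y u w. \<lbrakk>y \<in> carrier G \<rightarrow>\<^sub>E A; u \<in> X; w \<in> X;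
           \<And>g. g \<in> carrier G - {\<one>\<^bsub>G\<^esub>} \<Longrightarrow> y g = u g; \<And>g. g \<in> N \<Longrightarrow> y g = w g\<rbrakk> \<Longrightarrow> y \<in> X"
    using finite_type_glue_at_one[OF \<open>group G\<close> \<open>finite_type G A X\<close>] by blast
  obtain r where r: "N \<subseteq> word_ball G S r"
    using finite_subset_word_ball[OF \<open>finite N\<close> \<open>N \<subseteq> carrier G\<close>] by blast
  have "merge B {\<one>\<^bsub>G\<^esub>} (restrict x B, single \<one>\<^bsub>G\<^esub> a) \<in> restrict_set X (B \<union> {\<one>\<^bsub>G\<^esub>}) \<longleftrightarrow>
        merge C {\<one>\<^bsub>G\<^esub>} (x, single \<one>\<^bsub>G\<^esub> a) \<in> restrict_set X (C \<union> {\<one>\<^bsub>G\<^esub>})"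
    if C: "C \<subseteq> carrier G - {\<one>\<^bsub>G\<^esub>}" and B: "B = C \<inter> word_ball G S r"
      and x: "x \<in> restrict_set X C" and a: "a \<in> A" for C B x a
  proof -
    obtain u where u: "u \<in> X" "x = restrict u C"
      using x by (auto simp: restrict_set_def)
    define y where
      "y = (\<lambda>g\<in>carrier G. if g = \<one>\<^bsub>G\<^esub> then a else if g \<in> C then u g else z)"
    have mC: "merge C {\<one>\<^bsub>G\<^esub>} (x, single \<one>\<^bsub>G\<^esub> a) = restrict y (C \<union> {\<one>\<^bsub>G\<^esub>})"
      using C by (auto simp: merge_def single_def y_def u(2) fun_eq_iff)
    have mB: "merge B {\<one>\<^bsub>G\<^esub>} (restrict x B, single \<one>\<^bsub>G\<^esub> a) = restrict y (B \<union> {\<one>\<^bsub>G\<^esub>})"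
      using C by (auto simp: merge_def single_def y_def u(2) fun_eq_iff B)
    have fill: "y \<in> X" if "restrict y (B \<union> {\<one>\<^bsub>G\<^esub>}) \<in> restrict_set X (B \<union> {\<one>\<^bsub>G\<^esub>})"
    proof -
      obtain w where "w \<in> X" and "restrict y (B \<union> {\<one>\<^bsub>G\<^esub>}) = restrict w (B \<union> {\<one>\<^bsub>G\<^esub>})"
        using \<open>restrict y (B \<union> {\<one>\<^bsub>G\<^esub>}) \<in> restrict_set X (B \<union> {\<one>\<^bsub>G\<^esub>})\<close>
        by (auto simp: restrict_set_def)
      then have yw: "y g = w g" if "g \<in> B \<union> {\<one>\<^bsub>G\<^esub>}" for g
        using that by (metis restrict_apply')
      show ?thesis
      proof (rule glue)
        show "y \<in> carrier G \<rightarrow>\<^sub>E A"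
          using a \<open>z \<in> A\<close> PiE_mem[OF subsetD[OF XA u(1)]] by (simp add: y_def)
        show "(\<lambda>g\<in>carrier G. if g \<in> C then u g else z) \<in> X"
          using u(1) by (rule erase)
        show "(\<lambda>g\<in>carrier G. if g \<in> B \<union> {\<one>\<^bsub>G\<^esub>} then w g else z) \<in> X"
          using \<open>w \<in> X\<close> by (rule erase)
      next
        fix g
        assume "g \<in> carrier G - {\<one>\<^bsub>G\<^esub>}"
        then show "y g = (\<lambda>g\<in>carrier G. if g \<in> C then u g else z) g"
          by (simp add: y_def)
      next
        fix g
        assume "g \<in> N"
        \<comment> \<open>The ball contains \<open>g\<close>, so outside \<open>B \<union> {e}\<close> it lies outside \<open>C\<close> as well.\<close>
        then have "g \<in> carrier G" "g \<in> C \<Longrightarrow> g \<in> B"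
          using r \<open>N \<subseteq> carrier G\<close> by (auto simp: B)
        then show "y g = (\<lambda>g\<in>carrier G. if g \<in> B \<union> {\<one>\<^bsub>G\<^esub>} then w g else z) g"
          using yw[of g] by (auto simp: y_def)
      qed
    qed
    show ?thesis
      unfolding mC mB
    proof
      assume "restrict y (B \<union> {\<one>\<^bsub>G\<^esub>}) \<in> restrict_set X (B \<union> {\<one>\<^bsub>G\<^esub>})"
      then have "y \<in> X"
        by (rule fill)
      then show "restrict y (C \<union> {\<one>\<^bsub>G\<^esub>}) \<in> restrict_set X (C \<union> {\<one>\<^bsub>G\<^esub>})"
        unfolding restrict_set_def by (rule imageI)
    next
      assume "restrict y (C \<union> {\<one>\<^bsub>G\<^esub>}) \<in> restrict_set X (C \<union> {\<one>\<^bsub>G\<^esub>})"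
      then show "restrict y (B \<union> {\<one>\<^bsub>G\<^esub>}) \<in> restrict_set X (B \<union> {\<one>\<^bsub>G\<^esub>})"
        by (rule restrict_set_mono) (auto simp: B)
    qed
  qed
  then show ?thesis
    unfolding uniformly_avo_def Let_def by (intro exI[of _ r] ballI) auto
qed

end
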